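(* Let $k\ge 1$ and $t\ge 1$ be integers, and let $G_n=T_n\langle t,2t,\ldots,kt\rangle$ be the Toeplitz graph of order $n\ge(2k-1)t+1$. Then $$i(G_n)=\prod_{j=1}^{t}F_{k+1}\left(\left\lfloor\frac{n-j}{t}\right\rfloor+k+2\right).$$
   Context: For a finite simple graph $G$, $i(G)$ is the number of independent sets of $G$ (sets of pairwise non-adjacent vertices), including the empty set. Toeplitz graph: $T_n\langle t,2t,\ldots,kt\rangle$ is the simple graph with vertex set $\{1,\ldots,n\}$ in which $i,j$ are adjacent if and only if $|i-j|\in\{t,2t,\ldots,kt\}$. Generalized Fibonacci numbers: for $r\ge 2$, $F_r(1)=\cdots=F_r(r)=1$ and $F_r(m)=F_r(m-1)+F_r(m-r)$ for $m>r$. *)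

theory Defs
  imports "Graph_Theory.Pair_Digraph"
begin

text \<open>
  Graphs are taken from the Graph_Theory entry: a finite simple graph is a \<^locale>\<open>pair_graph\<close>,
  i.e. a finite, loop-free digraph whose arc relation \<^const>\<open>parcs\<close> is symmetric.
\<close>

definition independent_set :: "'a pair_pre_digraph \<Rightarrow> 'a set \<Rightarrow> bool" where
  "independent_set G A \<longleftrightarrow>
     A \<subseteq> pverts G \<and> pairwise (\<lambda>u v. (u, v) \<notin> parcs G) A"

definition num_independent_sets :: "'a pair_pre_digraph \<Rightarrow> nat" where
  "num_independent_sets G = card {A. independent_set G A}"

definition toeplitz_graph :: "nat \<Rightarrow> nat set \<Rightarrow> nat pair_pre_digraph" where
  "toeplitz_graph n D =
     \<lparr>pverts = {1..n},
      parcs = {(i, j). i \<in> {1..n} \<and> j \<in> {1..n} \<and> \<bar>int i - int j\<bar> \<in> int ` D}\<rparr>"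

lemma pair_graph_toeplitz_graph:
  assumes "0 \<notin> D"
  shows "pair_graph (toeplitz_graph n D)"
proof unfold_locales
  have "parcs (toeplitz_graph n D) \<subseteq> {1..n} \<times> {1..n}"
    by (auto simp: toeplitz_graph_def)
  then show "finite (parcs (toeplitz_graph n D))"
    by (rule finite_subset) simp
  show "symmetric (with_proj (toeplitz_graph n D))"
    by (auto simp: symmetric_def toeplitz_graph_def sym_def arcs_ends_def arc_to_ends_def
        abs_minus_commute)
qed (use assms in \<open>auto simp: toeplitz_graph_def\<close>)

text \<open>
  The generalized Fibonacci numbers $F_r(m)$ are meant for \<open>r \<ge> 2\<close> and \<open>m \<ge> 1\<close>; the values at
  \<open>m = 0\<close> and at \<open>r = 0\<close> are junk. The two lemmas below are the usual defining equations.
\<close>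

function gen_fib :: "nat \<Rightarrow> nat \<Rightarrow> nat" where
  "gen_fib r m =
     (if r = 0 \<or> m \<le> r then 1 else gen_fib r (m - 1) + gen_fib r (m - r))"
  by pat_completeness auto
termination by (relation "measure snd") auto

declare gen_fib.simps [simp del]

lemma gen_fib_init: "1 \<le> m \<Longrightarrow> m \<le> r \<Longrightarrow> gen_fib r m = 1"
  by (simp add: gen_fib.simps)

lemma gen_fib_rec:
  "2 \<le> r \<Longrightarrow> m > r \<Longrightarrow> gen_fib r m = gen_fib r (m - 1) + gen_fib r (m - r)"
  by (simp add: gen_fib.simps[of r m])

end

theory Submission
  imports Defs "HOL-Library.FuncSet"
begin

text \<open>
  The residue classes modulo \<open>t\<close> split the graph into \<open>t\<close> components with no edges in between.
  The component of \<open>j\<close> has vertices \<open>j, j + t, j + 2t, \<dots>\<close>, where two vertices are adjacent iff their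
  indices differ by at most \<open>k\<close>, so its independent sets are the sets of indices with gaps larger
  than \<open>k\<close>. Whether such a set contains its largest possible index gives the recurrence of the
  generalized Fibonacci numbers.
\<close>

text \<open>These are the independent sets of the \<open>k\<close>-th power of a path on
  \<open>m\<close> vertices, indexed from 0.\<close>

definition gapped_sets :: "nat \<Rightarrow> nat \<Rightarrow> nat set set" where
  "gapped_sets k m = {B. B \<subseteq> {..<m} \<and> (\<forall>a\<in>B. \<forall>l\<in>{1..k}. a + l \<notin> B)}"

lemma gapped_sets_0 [simp]: "gapped_sets k 0 = {{}}"
  by (auto simp: gapped_sets_def)

lemma finite_gapped_sets [simp]: "finite (gapped_sets k m)"
  by (rule finite_subset[of _ "Pow {..<m}"]) (auto simp: gapped_sets_def)

text \<open>A set containing \<open>m\<close> must avoid the \<open>k\<close> indices just below it,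
  so its remaining elements lie below \<open>m - k\<close>. For \<open>m \<le> k\<close> the
  truncated difference is 0, which leaves only the singleton of \<open>m\<close>.\<close>

lemma gapped_sets_Suc:
  "gapped_sets k (Suc m) = gapped_sets k m \<union> insert m ` gapped_sets k (m - k)"
proof (intro set_eqI iffI)
  fix B assume B: "B \<in> gapped_sets k (Suc m)"
  show "B \<in> gapped_sets k m \<union> insert m ` gapped_sets k (m - k)"
  proof (cases "m \<in> B")
    case True
    have "x < m - k" if "x \<in> B - {m}" for x
    proof (rule ccontr)
      assume "\<not> x < m - k"
      moreover have "x < m"
        using that B by (auto simp: gapped_sets_def less_Suc_eq)
      ultimately have "m - x \<in> {1..k}" "x + (m - x) = m"
        by auto
      then show False
        using B True that unfolding gapped_sets_def by (metis (no_types, lifting) DiffD1 mem_Collect_eq)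
    qed
    then have "B - {m} \<in> gapped_sets k (m - k)"
      using B by (auto simp: gapped_sets_def)
    moreover have "B = insert m (B - {m})"
      using True by auto
    ultimately show ?thesis by blast
  next
    case False
    then show ?thesis
      using B by (auto simp: gapped_sets_def less_Suc_eq)
  qed
next
  fix B assume "B \<in> gapped_sets k m \<union> insert m ` gapped_sets k (m - k)"
  then show "B \<in> gapped_sets k (Suc m)"
    by (fastforce simp: gapped_sets_def)
qed

text \<open>The shift by \<open>k + 1\<close> makes \<open>m = 0\<close> hit the last of the
  \<open>k + 1\<close> initial values of \<open>gen_fib (k + 1)\<close>; from there on both sides
  obey the same recurrence.\<close>

lemma card_gapped_sets:
  assumes "k \<ge> 1"
  shows "card (gapped_sets k m) = gen_fib (k + 1) (m + k + 1)"
proof (induction m rule: less_induct)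
  case (less m)
  show ?case
  proof (cases m)
    case 0
    then show ?thesis by (simp add: gen_fib_init)
  next
    case (Suc m')
    \<comment> \<open>This gives both the injectivity of inserting \<open>m'\<close> and the
      disjointness of the two families.\<close>
    have fresh: "m' \<notin> B" if "B \<in> gapped_sets k i" "i \<le> m'" for B i
      using that by (auto simp: gapped_sets_def)
    have "inj_on (insert m') (gapped_sets k (m' - k))"
      by (intro inj_onI) (meson diff_le_self fresh insert_ident)
    moreover have "gapped_sets k m' \<inter> insert m' ` gapped_sets k (m' - k) = {}"
      using fresh by blast
    ultimately have "card (gapped_sets k m) = card (gapped_sets k m') + card (gapped_sets k (m' - k))"
      by (simp add: Suc gapped_sets_Suc card_Un_disjoint card_image)
    also have "\<dots> = gen_fib (k + 1) (m' + k + 1) + gen_fib (k + 1) (m' - k + k + 1)"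
      using less.IH[of m'] less.IH[of "m' - k"] Suc by simp
    also have "gen_fib (k + 1) (m' - k + k + 1) = gen_fib (k + 1) (m' + 1)"
      \<comment> \<open>If \<open>m' < k\<close>, the arguments differ because of truncation, but
        both lie in the initial range, where the value is 1.\<close>
      by (cases "m' \<ge> k") (simp_all add: gen_fib_init)
    also have "gen_fib (k + 1) (m' + k + 1) + gen_fib (k + 1) (m' + 1) = gen_fib (k + 1) (m + k + 1)"
      using assms by (subst (3) gen_fib_rec) (simp_all add: Suc)
    finally show ?thesis .
  qed
qed

text \<open>By symmetry of adjacency, it suffices to look upwards from each vertex; this replaces
  absolute differences by sums that match the gap condition on indices.\<close>

lemma independent_set_toeplitz_graph_multiples:
  assumes "t \<ge> 1"
  shows "independent_set (toeplitz_graph n ((\<lambda>l. l * t) ` {1..k})) A \<longleftrightarrow>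
    A \<subseteq> {1..n} \<and> (\<forall>u\<in>A. \<forall>l\<in>{1..k}. u + l * t \<notin> A)"
    (is "_ \<longleftrightarrow> _ \<and> ?gap")
proof -
  have "pairwise (\<lambda>u v. (u, v) \<notin> parcs (toeplitz_graph n ((\<lambda>l. l * t) ` {1..k}))) A \<longleftrightarrow> ?gap"
    if A: "A \<subseteq> {1..n}"
  proof
    assume L: "pairwise (\<lambda>u v. (u, v) \<notin> parcs (toeplitz_graph n ((\<lambda>l. l * t) ` {1..k}))) A"
    show ?gap
    proof (intro ballI notI)
      fix u l assume *: "u \<in> A" "l \<in> {1..k}" "u + l * t \<in> A"
      \<comment> \<open>\<open>pairwise\<close> only constrains distinct elements.\<close>
      then have "u \<noteq> u + l * t" using assms by simp
      then have "(u, u + l * t) \<notin> parcs (toeplitz_graph n ((\<lambda>l. l * t) ` {1..k}))"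
        using L * by (auto simp: pairwise_def)
      moreover have "\<bar>int u - int (u + l * t)\<bar> = int (l * t)" by simp
      then have "\<bar>int u - int (u + l * t)\<bar> \<in> int ` (\<lambda>l. l * t) ` {1..k}"
        using *(2) by (metis image_eqI)
      ultimately show False
        using *(1,3) A unfolding toeplitz_graph_def by auto
    qed
  next
    assume R: ?gap
    show "pairwise (\<lambda>u v. (u, v) \<notin> parcs (toeplitz_graph n ((\<lambda>l. l * t) ` {1..k}))) A"
    proof (intro pairwiseI notI)
      fix u v
      assume uv: "u \<in> A" "v \<in> A" "(u, v) \<in> parcs (toeplitz_graph n ((\<lambda>l. l * t) ` {1..k}))"
      then obtain l where l: "l \<in> {1..k}" "\<bar>int u - int v\<bar> = int (l * t)"
        by (auto simp: toeplitz_graph_def simp del: of_nat_mult)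
      then have "v = u + l * t \<or> u = v + l * t" by linarith
      then show False using R uv l by blast
    qed
  qed
  then show ?thesis
    by (auto simp: independent_set_def toeplitz_graph_def)
qed

text \<open>Vertices start at 1, so the classes are represented by \<open>1, ..., t\<close>; hence
  the shift by one around \<open>mod\<close> and \<open>div\<close>.\<close>

lemma residue_decomposition:
  fixes t u :: nat
  assumes "t \<ge> 1" "u \<ge> 1"
  obtains j q where "j \<in> {1..t}" "u = j + q * t"
proof
  show "(u - 1) mod t + 1 \<in> {1..t}"
    using assms by (simp add: Suc_leI)
  show "u = (u - 1) mod t + 1 + (u - 1) div t * t"
    using assms mod_div_mult_eq[of "u - 1" t] by simp
qed

lemma residue_decomposition_unique:
  fixes t :: nat
  assumes "j \<in> {1..t}" "j' \<in> {1..t}" "j + q * t = j' + q' * t"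
  shows "j = j'" "q = q'"
proof -
  have *: "(i + p * t - 1) mod t = i - 1" if "i \<in> {1..t}" for i p
  proof -
    have "i + p * t - 1 = i - 1 + p * t" using that by simp
    then have "(i + p * t - 1) mod t = (i - 1) mod t" by (simp only: mod_mult_self1)
    also have "\<dots> = i - 1" using that by (intro mod_less) auto
    finally show ?thesis .
  qed
  have "j - 1 = j' - 1"
    using *[OF assms(1), of q] *[OF assms(2), of q'] assms(3) by simp
  then show "j = j'"
    using assms by auto
  then show "q = q'"
    using assms by auto
qed

text \<open>Slicing a vertex set into its index sets along the residue classes is a bijection onto a
  product of families of gapped sets.\<close>

lemma num_independent_sets_toeplitz_graph_multiples:
  assumes "t \<ge> 1" "n \<ge> t"
  shows "num_independent_sets (toeplitz_graph n ((\<lambda>l. l * t) ` {1..k})) =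
    (\<Prod>j = 1..t. card (gapped_sets k ((n - j) div t + 1)))"
proof -
  let ?I = "{A. independent_set (toeplitz_graph n ((\<lambda>l. l * t) ` {1..k})) A}"
  let ?P = "PiE {1..t} (\<lambda>j. gapped_sets k ((n - j) div t + 1))"
  \<comment> \<open>\<open>f\<close> slices and \<open>g\<close> reassembles. The restriction makes
    \<open>f A\<close> undefined outside \<open>{1..t}\<close>, as membership in \<open>PiE\<close>
    demands.\<close>
  define f where "f = (\<lambda>A. \<lambda>j\<in>{1..t}. {q. j + q * t \<in> A})"
  define g where "g = (\<lambda>h. {u. \<exists>j\<in>{1..t}. \<exists>q\<in>h j. u = j + q * t})"
  note indep = independent_set_toeplitz_graph_multiples[OF assms(1)]
  \<comment> \<open>The class of \<open>j\<close> has \<open>(n - j) div t + 1\<close> vertices;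
    \<open>n \<ge> t\<close> ensures \<open>j \<le> n\<close>, so that \<open>n - j\<close> is not
    truncated.\<close>
  have bound: "j + q * t \<le> n \<longleftrightarrow> q < (n - j) div t + 1" if "j \<in> {1..t}" for j q
  proof -
    have "q < (n - j) div t + 1 \<longleftrightarrow> q * t \<le> n - j"
      using assms(1) by (simp add: less_Suc_eq_le less_eq_div_iff_mult_less_eq)
    then show ?thesis using that assms(2) by auto
  qed
  \<comment> \<open>Uniqueness of the decomposition keeps different classes from
    interfering.\<close>
  have g_iff: "j + q * t \<in> g h \<longleftrightarrow> q \<in> h j" if "j \<in> {1..t}" for h j q
  proof
    assume "j + q * t \<in> g h"
    then obtain j' q' where jq': "j' \<in> {1..t}" "q' \<in> h j'" "j + q * t = j' + q' * t"
      unfolding g_def by blast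
    then show "q \<in> h j"
      using residue_decomposition_unique[OF that jq'(1,3)] by simp
  next
    assume "q \<in> h j"
    then show "j + q * t \<in> g h"
      unfolding g_def using that by blast
  qed
  have "bij_betw f ?I ?P"
  proof (rule bij_betw_byWitness[where f' = g])
    show "\<forall>A\<in>?I. g (f A) = A"
    proof (intro ballI set_eqI iffI)
      fix A u assume A: "A \<in> ?I"
      show "u \<in> A" if "u \<in> g (f A)"
        using that by (auto simp: g_def f_def)
      assume u: "u \<in> A"
      then have "u \<ge> 1" using A indep by auto
      then obtain j q where "j \<in> {1..t}" "u = j + q * t"
        using assms(1) residue_decomposition by blast
      then show "u \<in> g (f A)"
        using u by (auto simp: g_iff f_def)
    qed
    show "\<forall>h\<in>?P. f (g h) = h"
    proof
      fix h assume h: "h \<in> ?P"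
      show "f (g h) = h"
      proof
        fix j show "f (g h) j = h j"
        proof (cases "j \<in> {1..t}")
          case True
          then show ?thesis unfolding f_def by (simp only: restrict_apply' g_iff Collect_mem_eq)
        next
          case False
          then show ?thesis unfolding f_def PiE_arb[OF h False] by (simp only: restrict_def if_False)
        qed
      qed
    qed
    show "f ` ?I \<subseteq> ?P"
    proof (intro image_subsetI PiE_I)
      fix A j assume A: "A \<in> ?I" and j: "j \<in> {1..t}"
      have "q < (n - j) div t + 1" if "j + q * t \<in> A" for q
        using that A j indep bound by auto
      \<comment> \<open>Moving by \<open>l * t\<close> stays in the class and moves the index by
        \<open>l\<close>.\<close>
      moreover have "j + (q + l) * t \<notin> A" if "j + q * t \<in> A" "l \<in> {1..k}" for q l
        using that A unfolding indep mem_Collect_eq by (metis add.assoc add_mult_distrib)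
      ultimately show "f A j \<in> gapped_sets k ((n - j) div t + 1)"
        using j by (auto simp: f_def gapped_sets_def)
    qed (auto simp: f_def)
    show "g ` ?P \<subseteq> ?I"
    proof (intro image_subsetI)
      fix h assume h: "h \<in> ?P"
      have hj: "h j \<subseteq> {..<(n - j) div t + 1}" "\<forall>a\<in>h j. \<forall>l\<in>{1..k}. a + l \<notin> h j"
        if "j \<in> {1..t}" for j
        using PiE_mem[OF h that] by (auto simp: gapped_sets_def)
      have "g h \<subseteq> {1..n}"
      proof
        fix u assume "u \<in> g h"
        then obtain j q where jq: "j \<in> {1..t}" "q \<in> h j" "u = j + q * t"
          by (auto simp: g_def)
        then have "q < (n - j) div t + 1" using hj(1) by blast
        then show "u \<in> {1..n}" using jq bound by auto
      qed
      moreover have "u + l * t \<notin> g h" if u: "u \<in> g h" and l: "l \<in> {1..k}" for u l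
      proof -
        obtain j q where jq: "j \<in> {1..t}" "q \<in> h j" "u = j + q * t"
          using u by (auto simp: g_def)
        then have "u + l * t = j + (q + l) * t" by (simp add: add_mult_distrib)
        then show ?thesis using g_iff[OF jq(1)] hj(2)[OF jq(1)] jq(2) l by metis
      qed
      ultimately show "g h \<in> ?I" unfolding mem_Collect_eq indep by blast
    qed
  qed
  then show ?thesis
    by (simp add: num_independent_sets_def bij_betw_same_card card_PiE)
qed

theorem theorem2p7:
  fixes k t n :: nat
  assumes "k \<ge> 1" and "t \<ge> 1" and "n \<ge> (2 * k - 1) * t + 1"
  shows "num_independent_sets (toeplitz_graph n ((\<lambda>l. l * t) ` {1..k})) =
    (\<Prod>j = 1..t. gen_fib (k + 1) (nat \<lfloor>(real n - real j) / real t\<rfloor> + k + 2))"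
proof -
  \<comment> \<open>Since \<open>2 * k - 1 \<ge> 1\<close>, the bound on \<open>n\<close> yields
    \<open>n \<ge> t\<close>, so no class is empty.\<close>
  have "1 * t \<le> (2 * k - 1) * t"
    using assms(1) by (intro mult_right_mono) auto
  then have nt: "n \<ge> t" using assms(3) by linarith
  \<comment> \<open>As \<open>j \<le> t \<le> n\<close>, the real difference is that of the naturals
    and its floored quotient is \<open>div\<close>.\<close>
  have "nat \<lfloor>(real n - real j) / real t\<rfloor> = (n - j) div t" if "j \<in> {1..t}" for j
    using that nt by (simp add: floor_divide_of_nat_eq flip: of_nat_diff)
  then show ?thesis
    unfolding num_independent_sets_toeplitz_graph_multiples[OF assms(2) nt]
    by (intro prod.cong) (simp_all add: card_gapped_sets[OF assms(1)] algebra_simps)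
qed

end
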